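(* The conditional expected value of the complete-data log-likelihood for interval-censored multi-state data, $$\mathbb{E}[\ell^{\mathrm C}\mid \mathrm O,\widetilde\alpha]=\sum_{k=1}^K\sum_{(g,h)\in\mathcal V}\Big\{d_{gh}^k(\widetilde\alpha)\log(\alpha_{gh}^k)-\alpha_{gh}^k\,Y_g^k(\widetilde\alpha)\Big\},$$ viewed as a function of $\alpha$ over the optimisation region $$C_\alpha=\Big\{(\alpha_{gh}^k)_{g\neq h\in\mathcal H,\;k=1,\dots,K}\;:\;\alpha_{gh}^k\ge 0,\ \sum_{h\neq g}\alpha_{gh}^k\le 1\Big\},$$ is maximised by $$\alpha_{gh}^k=\begin{cases}\dfrac{d_{gh}^k(\widetilde\alpha)}{Y_g^k(\widetilde\alpha)}, & \mu_g^k=0,\\[2ex] \dfrac{d_{gh}^k(\widetilde\alpha)}{\sum_{h'\leftarrow g}d_{gh'}^k(\widetilde\alpha)}, & \mu_g^k>0,\end{cases}\qquad\text{with}\qquad \mu_g^k=\max\Big(0,\ \sum_{h'\leftarrow g}d_{gh'}^k(\widetilde\alpha)-Y_g^k(\widetilde\alpha)\Big),$$ where $\sum_{h'\leftarrow g}$ denotes the sum over all states $h'$ with $(g,h')\in\mathcal V$.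
   Context: States and transitions: $\mathcal H=\{1,\dots,H\}$ is a finite state set, and $\mathcal V\subseteq\{(g,h)\in\mathcal H\times\mathcal H: g\ne h\}$ is the set of possible direct transitions. The directed graph $(\mathcal H,\mathcal V)$ is acyclic. Time grid: $0=\tau_0<\tau_1<\dots<\tau_K<\infty$. The current estimate $\widetilde\alpha=(\widetilde\alpha_{gh}^k)$, $g\neq h\in\mathcal H$, $k=1,\dots,K$, is a fixed array with $\widetilde\alpha_{gh}^k\ge0$, $\sum_{h\neq g}\widetilde\alpha_{gh}^k\le1$ and $\widetilde\alpha_{gh}^k=0$ if $(g,h)\notin\mathcal V$. Under the law given $\widetilde\alpha$, the processes $X_1,\dots,X_n$ are independent Markov processes on $\mathcal H$ with right-continuous piecewise constant paths, changing state only at times $\tau_k$, with $\mathbb P(X_i(\tau_k)=h\mid X_i(\tau_{k-1})=g)=\widetilde\alpha_{gh}^k$ for $h\ne g$ and $1-\sum_{h\neq g}\widetilde\alpha_{gh}^k$ for $h=g$. $X_i(\tau_k-)$ is the state just before $\tau_k$, i.e. $X_i(\tau_{k-1})$. Observed data: subject $i$ is observed at times $t_{i0}<\dots<t_{in_i}$, all in $\{\tau_0,\dots,\tau_K\}$ and treated as fixed, in states $x_{i0},\dots,x_{in_i}$. Conditioning on $\mathrm O$ means conditioning on $X_i(t_{ij})=x_{ij}$ for all $i,j$, an event assumed to have positive probability under $\widetilde\alpha$. Counts: $d_{gh}^k=\sum_i\mathbf 1\{X_i(\tau_k-)=g,\ X_i(\tau_k)=h\}$ and $Y_g^k=\sum_i\mathbf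 1\{X_i(\tau_k-)=g\}$, sums over subjects $i\in\{1,\dots,n\}$ under observation in bin $k$, i.e. with $(\tau_{k-1},\tau_k]\subseteq(t_{i0},t_{in_i}]$. Their conditional expectations are $d_{gh}^k(\widetilde\alpha)=\mathbb E[d_{gh}^k\mid\mathrm O,\widetilde\alpha]$ and $Y_g^k(\widetilde\alpha)=\mathbb E[Y_g^k\mid\mathrm O,\widetilde\alpha]$. The discretised complete-data log-likelihood is $\ell^{\mathrm C}=\sum_{k=1}^K\sum_{(g,h)\in\mathcal V}\{d_{gh}^k\log(\alpha_{gh}^k)-\alpha_{gh}^kY_g^k\}$. Conventions: $\tfrac00=0$, $0\cdot\log 0=0$, and $c\log 0=-\infty$ for $c>0$. For $(g,h)\notin\mathcal V$ one has $d_{gh}^k(\widetilde\alpha)=0$, and the corresponding $\alpha_{gh}^k$ (which does not enter the objective) is $0$. *)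

theory Defs
  imports "HOL-Probability.Probability"
begin

text \<open>
  The array entry \<open>\<alpha> k g h\<close> belongs to time bin \<open>k\<close> and transition \<open>g \<rightarrow> h\<close>;
  \<open>X i s \<omega>\<close> is the state of subject \<open>i\<close> at time \<open>s\<close>.
\<close>

section \<open>Markov processes moving on a time grid\<close>

text \<open>A path is right-continuous, piecewise constant and changes state only at grid times iff two
  times with no grid point in \<open>{s<..s'}\<close> carry the same state.\<close>

definition changes_only_at :: "nat \<Rightarrow> (nat \<Rightarrow> real) \<Rightarrow> (real \<Rightarrow> nat) \<Rightarrow> bool" where
  "changes_only_at K \<tau> p \<longleftrightarrow>
     (\<forall>s s'. 0 \<le> s \<and> s \<le> s' \<and> (\<forall>k\<in>{1..K}. \<tau> k \<notin> {s<..s'}) \<longrightarrow> p s' = p s)"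

definition markov_process :: "'w measure \<Rightarrow> (real \<Rightarrow> 'w \<Rightarrow> nat) \<Rightarrow> bool" where
  "markov_process M Z \<longleftrightarrow>
     (\<forall>m s x. 0 \<le> s 0 \<and> strict_mono_on {..Suc m} s \<and>
        \<P>(\<omega> in M. \<forall>j\<le>m. Z (s j) \<omega> = x j) > 0 \<longrightarrow>
        \<P>(\<omega> in M. Z (s (Suc m)) \<omega> = x (Suc m) \<bar> \<forall>j\<le>m. Z (s j) \<omega> = x j) =
        \<P>(\<omega> in M. Z (s (Suc m)) \<omega> = x (Suc m) \<bar> Z (s m) \<omega> = x m))"

definition has_transition_probs ::
    "'w measure \<Rightarrow> nat \<Rightarrow> nat \<Rightarrow> (nat \<Rightarrow> real) \<Rightarrow> (nat \<Rightarrow> nat \<Rightarrow> nat \<Rightarrow> real) \<Rightarrow>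
     (real \<Rightarrow> 'w \<Rightarrow> nat) \<Rightarrow> bool" where
  "has_transition_probs M H K \<tau> a Z \<longleftrightarrow>
     (\<forall>k\<in>{1..K}. \<forall>g\<in>{1..H}. \<forall>h\<in>{1..H}.
        \<P>(\<omega> in M. Z (\<tau> (k - 1)) \<omega> = g) > 0 \<longrightarrow>
        \<P>(\<omega> in M. Z (\<tau> k) \<omega> = h \<bar> Z (\<tau> (k - 1)) \<omega> = g) =
          (if h \<noteq> g then a k g h else 1 - (\<Sum>h'\<in>{1..H} - {g}. a k g h')))"

section \<open>Observations and counts\<close>

definition observed_event ::
    "'w measure \<Rightarrow> nat \<Rightarrow> (nat \<Rightarrow> nat) \<Rightarrow> (nat \<Rightarrow> nat \<Rightarrow> real) \<Rightarrow> (nat \<Rightarrow> nat \<Rightarrow> nat) \<Rightarrow>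
     (nat \<Rightarrow> real \<Rightarrow> 'w \<Rightarrow> nat) \<Rightarrow> 'w set" where
  "observed_event M n N t x X =
     {\<omega> \<in> space M. \<forall>i\<in>{1..n}. \<forall>j\<le>N i. X i (t i j) \<omega> = x i j}"

definition under_observation ::
    "nat \<Rightarrow> (nat \<Rightarrow> nat) \<Rightarrow> (nat \<Rightarrow> nat \<Rightarrow> real) \<Rightarrow> (nat \<Rightarrow> real) \<Rightarrow> nat \<Rightarrow> nat set" where
  "under_observation n N t \<tau> k =
     {i \<in> {1..n}. {\<tau> (k - 1)<..\<tau> k} \<subseteq> {t i 0<..t i (N i)}}"

definition left_state :: "(real \<Rightarrow> nat) \<Rightarrow> real \<Rightarrow> nat" where
  "left_state p s = Lim (at_left s) p"

lemma left_state_grid: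
  assumes "changes_only_at K \<tau> p" "0 \<le> \<tau> 0" "strict_mono_on {..K} \<tau>" "k \<in> {1..K}"
  shows "left_state p (\<tau> k) = p (\<tau> (k - 1))"
proof -
  have lt: "\<tau> (k - 1) < \<tau> k"
    using assms(3,4) by (auto simp: strict_mono_on_def)
  have nonneg: "0 \<le> \<tau> (k - 1)"
    using assms(2,4) strict_mono_on_leD[OF assms(3), of 0 "k - 1"] by force
  have "eventually (\<lambda>s. s \<in> {\<tau> (k - 1)<..<\<tau> k}) (at_left (\<tau> k))"
    using lt by (rule eventually_at_left_real)
  then have "eventually (\<lambda>s. p s = p (\<tau> (k - 1))) (at_left (\<tau> k))"
  proof eventually_elim
    case (elim s)
    have "\<tau> l \<notin> {\<tau> (k - 1)<..s}" if "l \<in> {1..K}" for l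
    proof (cases "l \<le> k - 1")
      case True
      then show ?thesis
        using strict_mono_on_leD[OF assms(3), of l "k - 1"] that assms(4) by force
    next
      case False
      then show ?thesis
        using strict_mono_on_leD[OF assms(3), of k l] that assms(4) elim by force
    qed
    then show ?case
      using assms(1) nonneg elim unfolding changes_only_at_def by auto
  qed
  then have "(p \<longlongrightarrow> p (\<tau> (k - 1))) (at_left (\<tau> k))"
    by (rule tendsto_eventually)
  then show ?thesis
    unfolding left_state_def by (intro tendsto_Lim) auto
qed

definition transition_count ::
    "nat \<Rightarrow> (nat \<Rightarrow> nat) \<Rightarrow> (nat \<Rightarrow> nat \<Rightarrow> real) \<Rightarrow> (nat \<Rightarrow> real) \<Rightarrow>
     (nat \<Rightarrow> real \<Rightarrow> 'w \<Rightarrow> nat) \<Rightarrow> 'w \<Rightarrow> nat \<Rightarrow> nat \<Rightarrow> nat \<Rightarrow> real" where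
  "transition_count n N t \<tau> X \<omega> k g h =
     (\<Sum>i\<in>under_observation n N t \<tau> k.
        of_bool (left_state (\<lambda>s. X i s \<omega>) (\<tau> k) = g \<and> X i (\<tau> k) \<omega> = h))"

definition at_risk_count ::
    "nat \<Rightarrow> (nat \<Rightarrow> nat) \<Rightarrow> (nat \<Rightarrow> nat \<Rightarrow> real) \<Rightarrow> (nat \<Rightarrow> real) \<Rightarrow>
     (nat \<Rightarrow> real \<Rightarrow> 'w \<Rightarrow> nat) \<Rightarrow> 'w \<Rightarrow> nat \<Rightarrow> nat \<Rightarrow> real" where
  "at_risk_count n N t \<tau> X \<omega> k g =
     (\<Sum>i\<in>under_observation n N t \<tau> k. of_bool (left_state (\<lambda>s. X i s \<omega>) (\<tau> k) = g))"

section \<open>The log-likelihood and its conditional expectation\<close>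

definition xlog :: "real \<Rightarrow> ereal" where
  "xlog a = (if a = 0 then -\<infinity> else ereal (ln a))"

text \<open>Values lie in \<open>ereal\<close>, where \<open>0 * -\<infinity> = 0\<close> and \<open>c * -\<infinity> = -\<infinity>\<close> for \<open>c > 0\<close>.\<close>

definition complete_loglik ::
    "nat \<Rightarrow> (nat \<times> nat) set \<Rightarrow> (nat \<Rightarrow> nat \<Rightarrow> nat \<Rightarrow> real) \<Rightarrow> (nat \<Rightarrow> nat \<Rightarrow> real) \<Rightarrow>
     (nat \<Rightarrow> nat \<Rightarrow> nat \<Rightarrow> real) \<Rightarrow> ereal" where
  "complete_loglik K V d Y \<alpha> =
     (\<Sum>k\<in>{1..K}. \<Sum>(g, h)\<in>V. ereal (d k g h) * xlog (\<alpha> k g h) - ereal (\<alpha> k g h * Y k g))"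

text \<open>Conditioning on an event \<open>A\<close> of positive probability is integration against
  \<open>uniform_measure M A\<close>, i.e. against \<open>P(\<cdot> \<inter> A) / P(A)\<close>. The extended-real version is positive
  part minus negative part; it is used only for integrands bounded above, so that the subtraction
  is never \<open>\<infinity> - \<infinity>\<close>.\<close>

definition cond_expectation :: "'w measure \<Rightarrow> 'w set \<Rightarrow> ('w \<Rightarrow> real) \<Rightarrow> real" where
  "cond_expectation M A f = (\<integral>\<omega>. f \<omega> \<partial>uniform_measure M A)"

definition cond_expectation_ereal :: "'w measure \<Rightarrow> 'w set \<Rightarrow> ('w \<Rightarrow> ereal) \<Rightarrow> ereal" where
  "cond_expectation_ereal M A f =
     enn2ereal (\<integral>\<^sup>+\<omega>. e2ennreal (f \<omega>) \<partial>uniform_measure M A) -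
     enn2ereal (\<integral>\<^sup>+\<omega>. e2ennreal (- f \<omega>) \<partial>uniform_measure M A)"

section \<open>The optimisation problem\<close>

definition alpha_region :: "nat \<Rightarrow> nat \<Rightarrow> (nat \<Rightarrow> nat \<Rightarrow> nat \<Rightarrow> real) set" where
  "alpha_region H K =
     {\<alpha>. \<forall>k\<in>{1..K}. \<forall>g\<in>{1..H}.
        (\<forall>h\<in>{1..H} - {g}. 0 \<le> \<alpha> k g h) \<and> (\<Sum>h\<in>{1..H} - {g}. \<alpha> k g h) \<le> 1}"

definition mu ::
    "(nat \<times> nat) set \<Rightarrow> (nat \<Rightarrow> nat \<Rightarrow> nat \<Rightarrow> real) \<Rightarrow> (nat \<Rightarrow> nat \<Rightarrow> real) \<Rightarrow>
     nat \<Rightarrow> nat \<Rightarrow> real" where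
  "mu V d Y k g = max 0 ((\<Sum>h' | (g, h') \<in> V. d k g h') - Y k g)"

definition alpha_update ::
    "(nat \<times> nat) set \<Rightarrow> (nat \<Rightarrow> nat \<Rightarrow> nat \<Rightarrow> real) \<Rightarrow> (nat \<Rightarrow> nat \<Rightarrow> real) \<Rightarrow>
     nat \<Rightarrow> nat \<Rightarrow> nat \<Rightarrow> real" where
  "alpha_update V d Y k g h =
     (if mu V d Y k g = 0 then d k g h / Y k g
      else d k g h / (\<Sum>h' | (g, h') \<in> V. d k g h'))"

end

theory Submission
  imports Defs
begin

text \<open>
  Every jump out of \<open>g\<close> in bin \<open>k\<close> is made by a subject at risk in \<open>g\<close>, so
  \<open>\<Sum>\<^bsub>h\<noteq>g\<^esub> d k g h \<le> Y k g\<close> holds pathwise and hence in conditional expectation. Consequently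
  \<open>mu\<close> vanishes identically, the constraint \<open>\<Sum>\<^bsub>h\<noteq>g\<^esub> \<alpha> k g h \<le> 1\<close> is satisfied by the unconstrained
  maximisers \<open>d / Y\<close> of the separate terms \<open>d * ln \<alpha> - \<alpha> * Y\<close>, and no multiplier is needed.
  On the region all terms of the log-likelihood are nonpositive, so its conditional expectation
  is computed by nonnegative integration, where infinite values are harmless.
\<close>

text \<open>For positive \<open>d\<close> this is the tangent bound ln u \<le> u - 1 at u =
  \<open>b * y / d\<close>: the concave map d ln b - b y has its stationary point at
  \<open>d / y\<close>. The bound \<open>d \<le> y\<close> makes \<open>y\<close> nonnegative, and
  positive once \<open>d\<close> is, so division by zero occurs only as 0/0 = 0.\<close>

lemma xlog_term_le:
  assumes "0 \<le> d" "d \<le> y" "0 \<le> b"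
  shows "ereal d * xlog b - ereal (b * y) \<le> ereal d * xlog (d / y) - ereal (d / y * y)"
\<comment> \<open>If \<open>d = 0\<close>, the right side is 0 and the left is
  \<open>- b * y\<close>; if only \<open>b = 0\<close>, the left side is -\<infinity>.\<close>
proof (cases "d = 0 \<or> b = 0")
  case True
  then show ?thesis
    using assms by (cases "d = 0") (auto simp: xlog_def zero_ereal_def[symmetric])
next
  case False
  then have pos: "0 < d" "0 < y" "0 < b"
    using assms by auto
  have "ln (b * y / d) \<le> b * y / d - 1"
    using pos by (intro ln_le_minus_one) auto
  then have "d * ln (b * y / d) \<le> d * (b * y / d - 1)"
    using pos by (intro mult_left_mono) auto
  also have "\<dots> = b * y - d"
    using pos by (simp add: field_simps)
  finally have "d * ln b - b * y \<le> d * ln (d / y) - d"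
    using pos by (simp add: ln_mult ln_div algebra_simps)
  then show ?thesis
    using pos by (simp add: xlog_def)
qed

text \<open>The objective is separable: each entry of \<open>\<alpha>\<close> occurs in a single
  term, so termwise maximisation suffices.\<close>

lemma complete_loglik_le_ratio:
  assumes "\<And>k g h. k \<in> {1..K} \<Longrightarrow> (g, h) \<in> V \<Longrightarrow>
      0 \<le> d k g h \<and> d k g h \<le> Y k g \<and> 0 \<le> \<alpha> k g h \<and> \<beta> k g h = d k g h / Y k g"
  shows "complete_loglik K V d Y \<alpha> \<le> complete_loglik K V d Y \<beta>"
proof -
  have "ereal (d k g h) * xlog (\<alpha> k g h) - ereal (\<alpha> k g h * Y k g) \<le>
      ereal (d k g h) * xlog (\<beta> k g h) - ereal (\<beta> k g h * Y k g)"
    if "k \<in> {1..K}" "(g, h) \<in> V" for k g h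
    using assms[OF that] xlog_term_le[of "d k g h" "Y k g" "\<alpha> k g h"] by metis
  then show ?thesis
    unfolding complete_loglik_def case_prod_beta by (intro sum_mono) auto
qed

text \<open>A single entry is at most its row sum because the other entries are nonnegative. The
  upper bound 1 is what makes the logarithms nonpositive.\<close>

lemma alpha_region_bounds:
  assumes "\<alpha> \<in> alpha_region H K" "k \<in> {1..K}" "g \<in> {1..H}" "h \<in> {1..H}" "g \<noteq> h"
  shows "0 \<le> \<alpha> k g h" "\<alpha> k g h \<le> 1"
proof -
  have nn: "\<forall>h\<in>{1..H} - {g}. 0 \<le> \<alpha> k g h" and le: "(\<Sum>h\<in>{1..H} - {g}. \<alpha> k g h) \<le> 1"
    using assms unfolding alpha_region_def by blast+
  have "\<alpha> k g h \<le> (\<Sum>h\<in>{1..H} - {g}. \<alpha> k g h)"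
    using assms nn by (intro member_le_sum) auto
  with le nn assms show "0 \<le> \<alpha> k g h" "\<alpha> k g h \<le> 1"
    by auto
qed

text \<open>The negated log-likelihood, faithful for nonnegative counts and entries of
  \<open>\<alpha>\<close> in [0,1]; elsewhere the coercions truncate at 0. The deterministic factor,
  possibly infinite, stands on the left so that it can be pulled out of a nonnegative
  integral.\<close>

definition neg_loglik ::
    "nat \<Rightarrow> (nat \<times> nat) set \<Rightarrow> (nat \<Rightarrow> nat \<Rightarrow> nat \<Rightarrow> real) \<Rightarrow> (nat \<Rightarrow> nat \<Rightarrow> real) \<Rightarrow>
     (nat \<Rightarrow> nat \<Rightarrow> nat \<Rightarrow> real) \<Rightarrow> ennreal" where
  "neg_loglik K V d Y \<alpha> =
     (\<Sum>k\<in>{1..K}. \<Sum>(g, h)\<in>V.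
        e2ennreal (- xlog (\<alpha> k g h)) * ennreal (d k g h) + ennreal (\<alpha> k g h) * ennreal (Y k g))"

lemma xlog_nonpos: "0 \<le> b \<Longrightarrow> b \<le> 1 \<Longrightarrow> xlog b \<le> 0"
  by (auto simp: xlog_def)

text \<open>Negation distributes over these extended-real sums because all summands have the same
  sign, which excludes \<infinity> - \<infinity>.\<close>

lemma ereal_sum_uminus_enn2ereal:
  assumes "\<And>z. z \<in> A \<Longrightarrow> f z = - enn2ereal (g z)"
  shows "(\<Sum>z\<in>A. f z) = - enn2ereal (\<Sum>z\<in>A. g z)"
  using assms
proof (induction A rule: infinite_finite_induct)
  case (insert z A)
  then have "(\<Sum>z\<in>insert z A. f z) = - enn2ereal (g z) + - enn2ereal (\<Sum>z\<in>A. g z)"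
    by simp
  also have "\<dots> = - (enn2ereal (g z) + enn2ereal (\<Sum>z\<in>A. g z))"
    by (cases "enn2ereal (g z)"; cases "enn2ereal (\<Sum>z\<in>A. g z)")
      (use enn2ereal_nonneg[of "g z"] enn2ereal_nonneg[of "\<Sum>z\<in>A. g z"] in auto)
  finally show ?case
    using insert.hyps by (simp add: plus_ennreal.rep_eq)
qed (auto simp: zero_ennreal.rep_eq)

text \<open>For \<open>b\<close> in [0,1] the value \<open>- xlog b\<close> is nonnegative, so
  \<open>e2ennreal\<close> loses nothing. At \<open>b = 0\<close> both number systems agree that 0
  times infinity is 0.\<close>

lemma xlog_term_eq_uminus:
  assumes "0 \<le> d" "0 \<le> y" "0 \<le> b" "b \<le> 1"
  shows "ereal d * xlog b - ereal (b * y) =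
    - enn2ereal (e2ennreal (- xlog b) * ennreal d + ennreal b * ennreal y)"
proof -
  have "enn2ereal (e2ennreal (- xlog b) * ennreal d + ennreal b * ennreal y) =
      - xlog b * ereal d + ereal (b * y)"
    using assms xlog_nonpos[OF assms(3,4)]
    by (simp add: plus_ennreal.rep_eq times_ennreal.rep_eq enn2ereal_e2ennreal)
  moreover have "ereal d * xlog b - ereal (b * y) = - (- xlog b * ereal d + ereal (b * y))"
    by (cases "xlog b"; cases "d = 0") (use assms in \<open>auto simp: mult.commute\<close>)
  ultimately show ?thesis
    by simp
qed

lemma complete_loglik_eq_uminus:
  assumes "\<And>k g h. k \<in> {1..K} \<Longrightarrow> (g, h) \<in> V \<Longrightarrow>
      0 \<le> d k g h \<and> 0 \<le> Y k g \<and> 0 \<le> \<alpha> k g h \<and> \<alpha> k g h \<le> 1"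
  shows "complete_loglik K V d Y \<alpha> = - enn2ereal (neg_loglik K V d Y \<alpha>)"
  unfolding complete_loglik_def neg_loglik_def
  by (intro ereal_sum_uminus_enn2ereal)
    (use assms in \<open>auto simp: xlog_term_eq_uminus split: prod.splits\<close>)

text \<open>The log-likelihood is linear in the counts with deterministic coefficients. Nonnegative
  integration respects this linearity even for an infinite coefficient, that is, where
  \<open>\<alpha> k g h = 0\<close>.\<close>

lemma cond_expectation_ereal_complete_loglik:
  assumes "\<And>k g h. k \<in> {1..K} \<Longrightarrow> (g, h) \<in> V \<Longrightarrow> 0 \<le> \<alpha> k g h \<and> \<alpha> k g h \<le> 1"
    and D: "\<And>k g h. k \<in> {1..K} \<Longrightarrow> (g, h) \<in> V \<Longrightarrow>
      integrable (uniform_measure M A) (\<lambda>\<omega>. D \<omega> k g h)" "\<And>\<omega> k g h. 0 \<le> D \<omega> k g h"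
    and Y: "\<And>k g h. k \<in> {1..K} \<Longrightarrow> (g, h) \<in> V \<Longrightarrow>
      integrable (uniform_measure M A) (\<lambda>\<omega>. Y \<omega> k g)" "\<And>\<omega> k g. 0 \<le> Y \<omega> k g"
  shows "cond_expectation_ereal M A (\<lambda>\<omega>. complete_loglik K V (D \<omega>) (Y \<omega>) \<alpha>) =
    complete_loglik K V (\<lambda>k g h. cond_expectation M A (\<lambda>\<omega>. D \<omega> k g h))
      (\<lambda>k g. cond_expectation M A (\<lambda>\<omega>. Y \<omega> k g)) \<alpha>"
    (is "_ = complete_loglik K V ?d ?y \<alpha>")
proof -
  let ?P = "uniform_measure M A"
  have meas: "(\<lambda>\<omega>. ennreal (D \<omega> k g h)) \<in> borel_measurable ?P"
      "(\<lambda>\<omega>. ennreal (Y \<omega> k g)) \<in> borel_measurable ?P"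
    if "k \<in> {1..K}" "(g, h) \<in> V" for k g h
    using D(1)[OF that] Y(1)[OF that]
    by (auto dest!: borel_measurable_integrable intro: measurable_compose[OF _ measurable_ennreal])
  let ?T = "\<lambda>\<omega> k g h. e2ennreal (- xlog (\<alpha> k g h)) * ennreal (D \<omega> k g h) +
    ennreal (\<alpha> k g h) * ennreal (Y \<omega> k g)"
  have T_meas: "(\<lambda>\<omega>. ?T \<omega> k g h) \<in> borel_measurable ?P" if "k \<in> {1..K}" "(g, h) \<in> V" for k g h
    using meas[OF that] by (intro borel_measurable_add borel_measurable_times_ennreal borel_measurable_const)
  have T_integral: "(\<integral>\<^sup>+\<omega>. ?T \<omega> k g h \<partial>?P) =
      e2ennreal (- xlog (\<alpha> k g h)) * ennreal (?d k g h) + ennreal (\<alpha> k g h) * ennreal (?y k g)"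
    if "k \<in> {1..K}" "(g, h) \<in> V" for k g h
    using meas[OF that] D(1)[OF that] Y(1)[OF that] D(2) Y(2)
    by (simp add: nn_integral_add nn_integral_cmult nn_integral_eq_integral cond_expectation_def)
  have "(\<integral>\<^sup>+\<omega>. neg_loglik K V (D \<omega>) (Y \<omega>) \<alpha> \<partial>?P) =
      (\<Sum>k\<in>{1..K}. \<integral>\<^sup>+\<omega>. (\<Sum>p\<in>V. ?T \<omega> k (fst p) (snd p)) \<partial>?P)"
    unfolding neg_loglik_def case_prod_beta
    by (intro nn_integral_sum borel_measurable_sum T_meas) auto
  also have "\<dots> = (\<Sum>k\<in>{1..K}. \<Sum>p\<in>V. \<integral>\<^sup>+\<omega>. ?T \<omega> k (fst p) (snd p) \<partial>?P)"
    by (intro sum.cong refl nn_integral_sum T_meas) auto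
  also have "\<dots> = neg_loglik K V ?d ?y \<alpha>"
    unfolding neg_loglik_def case_prod_beta
    by (intro sum.cong refl T_integral) auto
  finally have "(\<integral>\<^sup>+\<omega>. neg_loglik K V (D \<omega>) (Y \<omega>) \<alpha> \<partial>?P) = neg_loglik K V ?d ?y \<alpha>" .
  moreover have "complete_loglik K V (D \<omega>) (Y \<omega>) \<alpha> = - enn2ereal (neg_loglik K V (D \<omega>) (Y \<omega>) \<alpha>)" for \<omega>
    using assms by (intro complete_loglik_eq_uminus) auto
  moreover have "complete_loglik K V ?d ?y \<alpha> = - enn2ereal (neg_loglik K V ?d ?y \<alpha>)"
    using assms by (intro complete_loglik_eq_uminus) (auto simp: cond_expectation_def)
  \<comment> \<open>The integrand is nonpositive, so its positive part integrates to 0 and only the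
    negative part remains.\<close>
  ultimately show ?thesis
    by (simp add: cond_expectation_ereal_def e2ennreal_neg zero_ennreal.rep_eq)
qed

lemma finite_under_observation [simp]: "finite (under_observation n N t \<tau> k)"
  by (simp add: under_observation_def)

lemma transition_count_nonneg: "0 \<le> transition_count n N t \<tau> X \<omega> k g h"
  by (simp add: transition_count_def sum_nonneg)

lemma at_risk_count_nonneg: "0 \<le> at_risk_count n N t \<tau> X \<omega> k g"
  by (simp add: at_risk_count_def sum_nonneg)

text \<open>Each subject ends the bin in one state only, so after swapping the sums at most one
  indicator per subject is 1.\<close>

lemma sum_transition_count_le:
  assumes "finite S"
  shows "(\<Sum>h\<in>S. transition_count n N t \<tau> X \<omega> k g h) \<le> at_risk_count n N t \<tau> X \<omega> k g"
proof -
  have "(\<Sum>h\<in>S. of_bool (l = g \<and> z = h)) \<le> (of_bool (l = g) :: real)" for l z :: nat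
    using assms by (cases "l = g") (auto simp: of_bool_def)
  then show ?thesis
    unfolding transition_count_def at_risk_count_def by (subst sum.swap) (rule sum_mono)
qed

text \<open>Independence includes measurability of the whole path map into the product space;
  composing with a coordinate projection gives the state at one time.\<close>

lemma indep_vars_path_measurable:
  assumes "prob_space M"
    and "prob_space.indep_vars M (\<lambda>_. PiM {0..} (\<lambda>_. count_space S))
           (\<lambda>i \<omega>. \<lambda>s\<in>{0..}. X i s \<omega>) I"
    and "i \<in> I" "0 \<le> (s :: real)"
  shows "X i s \<in> measurable M (count_space S)"
proof -
  interpret prob_space M by fact
  have "(\<lambda>\<omega>. \<lambda>s\<in>{0..}. X i s \<omega>) \<in> measurable M (PiM {0..} (\<lambda>_. count_space S))"
    using assms(2,3) by (simp add: indep_vars_def)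
  from measurable_compose[OF this measurable_component_singleton[of s]] show ?thesis
    using assms(4) by simp
qed

lemma measurable_count_space_eq_event:
  assumes "f \<in> measurable M (count_space S)"
  shows "{\<omega> \<in> space M. f \<omega> = c} \<in> sets M"
proof -
  \<comment> \<open>The intersection with \<open>S\<close> covers values \<open>c\<close> outside
    \<open>S\<close>, where the event is empty.\<close>
  have "{\<omega> \<in> space M. f \<omega> = c} = f -` ({c} \<inter> S) \<inter> space M"
    using measurable_space[OF assms] by auto
  then show ?thesis
    using measurable_sets[OF assms, of "{c} \<inter> S"] by simp
qed

theorem proposition2:
  fixes M :: "'w measure"
    and H K n :: nat
    and V :: "(nat \<times> nat) set"
    and \<tau> :: "nat \<Rightarrow> real"
    and a :: "nat \<Rightarrow> nat \<Rightarrow> nat \<Rightarrow> real"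
    and X :: "nat \<Rightarrow> real \<Rightarrow> 'w \<Rightarrow> nat"
    and N :: "nat \<Rightarrow> nat"
    and t :: "nat \<Rightarrow> nat \<Rightarrow> real"
    and x :: "nat \<Rightarrow> nat \<Rightarrow> nat"
  assumes "V \<subseteq> {(g, h). g \<in> {1..H} \<and> h \<in> {1..H} \<and> g \<noteq> h}"
    and "acyclic V"
    and "\<tau> 0 = 0"
    and "strict_mono_on {..K} \<tau>"
    and "a \<in> alpha_region H K"
    and "\<And>k g h. \<lbrakk>k \<in> {1..K}; g \<in> {1..H}; h \<in> {1..H}; g \<noteq> h; (g, h) \<notin> V\<rbrakk> \<Longrightarrow> a k g h = 0"
    and "prob_space M"
    and "prob_space.indep_vars M (\<lambda>_. PiM {0..} (\<lambda>_. count_space {1..H}))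
           (\<lambda>i \<omega>. \<lambda>s\<in>{0..}. X i s \<omega>) {1..n}"
    and "\<And>i. i \<in> {1..n} \<Longrightarrow> markov_process M (X i)"
    and "\<And>i \<omega>. \<lbrakk>i \<in> {1..n}; \<omega> \<in> space M\<rbrakk> \<Longrightarrow> changes_only_at K \<tau> (\<lambda>s. X i s \<omega>)"
    and "\<And>i. i \<in> {1..n} \<Longrightarrow> has_transition_probs M H K \<tau> a (X i)"
    and "\<And>i. i \<in> {1..n} \<Longrightarrow> strict_mono_on {..N i} (t i)"
    and "\<And>i j. \<lbrakk>i \<in> {1..n}; j \<le> N i\<rbrakk> \<Longrightarrow> t i j \<in> \<tau> ` {..K}"
    and "\<And>i j. \<lbrakk>i \<in> {1..n}; j \<le> N i\<rbrakk> \<Longrightarrow> x i j \<in> {1..H}"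
    and "measure M (observed_event M n N t x X) > 0"
  shows "let Obs = observed_event M n N t x X;
             EL = (\<lambda>\<alpha>. cond_expectation_ereal M Obs
                     (\<lambda>\<omega>. complete_loglik K V (transition_count n N t \<tau> X \<omega>)
                             (at_risk_count n N t \<tau> X \<omega>) \<alpha>));
             d = (\<lambda>k g h. cond_expectation M Obs (\<lambda>\<omega>. transition_count n N t \<tau> X \<omega> k g h));
             Y = (\<lambda>k g. cond_expectation M Obs (\<lambda>\<omega>. at_risk_count n N t \<tau> X \<omega> k g))
         in (\<forall>\<alpha>\<in>alpha_region H K. EL \<alpha> = complete_loglik K V d Y \<alpha>) \<and>
            is_arg_max EL (\<lambda>\<alpha>. \<alpha> \<in> alpha_region H K) (alpha_update V d Y)"
proof -
  let ?O = "observed_event M n N t x X"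
  let ?P = "uniform_measure M ?O"
  let ?D = "transition_count n N t \<tau> X" and ?R = "at_risk_count n N t \<tau> X"
  let ?d = "\<lambda>k g h. cond_expectation M ?O (\<lambda>\<omega>. ?D \<omega> k g h)"
  let ?y = "\<lambda>k g. cond_expectation M ?O (\<lambda>\<omega>. ?R \<omega> k g)"
  let ?EL = "\<lambda>\<alpha>. cond_expectation_ereal M ?O (\<lambda>\<omega>. complete_loglik K V (?D \<omega>) (?R \<omega>) \<alpha>)"
  interpret prob_space M by fact
  have "emeasure M ?O \<noteq> 0"
    using assms(15) by (auto simp: measure_def)
  then interpret P: prob_space ?P
    by (intro prob_space_uniform_measure) auto
  have X_event: "{\<omega> \<in> space M. X i s \<omega> = c} \<in> sets M" if "i \<in> {1..n}" "0 \<le> s" for i s c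
    using indep_vars_path_measurable[OF assms(7,8) that] by (rule measurable_count_space_eq_event)
  have \<tau>_nonneg: "0 \<le> \<tau> k" if "k \<le> K" for k
    using strict_mono_on_leD[OF assms(4), of 0 k] assms(3) that by auto
  have left_eq: "left_state (\<lambda>s. X i s \<omega>) (\<tau> k) = X i (\<tau> (k - 1)) \<omega>"
    if "i \<in> {1..n}" "\<omega> \<in> space M" "k \<in> {1..K}" for i \<omega> k
    using left_state_grid[OF assms(10)[OF that(1,2)] _ assms(4) that(3)] assms(3) by simp
  \<comment> \<open>A left limit over uncountably many times is not obviously measurable; it is
    replaced by the state at the previous grid point.\<close>
  have left_event: "{\<omega> \<in> space M. left_state (\<lambda>s. X i s \<omega>) (\<tau> k) = g} \<in> sets M"
    if "i \<in> {1..n}" "k \<in> {1..K}" for i k g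
  proof -
    have "{\<omega> \<in> space M. left_state (\<lambda>s. X i s \<omega>) (\<tau> k) = g} = {\<omega> \<in> space M. X i (\<tau> (k - 1)) \<omega> = g}"
      using left_eq that by auto
    then show ?thesis
      using X_event[OF that(1) \<tau>_nonneg, of "k - 1" g] that(2) by force
  qed
  have int_of_bool: "integrable ?P (\<lambda>\<omega>. of_bool (Q \<omega>) :: real)" if "{\<omega> \<in> space M. Q \<omega>} \<in> sets M" for Q
  proof (rule P.integrable_const_bound[where B = 1])
    have "Measurable.pred M Q"
      using that by (simp add: pred_def)
    then show "(\<lambda>\<omega>. of_bool (Q \<omega>) :: real) \<in> borel_measurable ?P"
      by simp
  qed simp
  have int_D: "integrable ?P (\<lambda>\<omega>. ?D \<omega> k g h)" if "k \<in> {1..K}" for k g h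
    unfolding transition_count_def
  proof (intro Bochner_Integration.integrable_sum int_of_bool sets.sets_Collect_conj)
    fix i assume "i \<in> under_observation n N t \<tau> k"
    then have "i \<in> {1..n}"
      by (simp add: under_observation_def)
    then show "{\<omega> \<in> space M. left_state (\<lambda>s. X i s \<omega>) (\<tau> k) = g} \<in> sets M"
      "{\<omega> \<in> space M. X i (\<tau> k) \<omega> = h} \<in> sets M"
      using left_event X_event \<tau>_nonneg that by auto
  qed
  have int_R: "integrable ?P (\<lambda>\<omega>. ?R \<omega> k g)" if "k \<in> {1..K}" for k g
    unfolding at_risk_count_def
    by (intro Bochner_Integration.integrable_sum int_of_bool left_event)
      (use that in \<open>auto simp: under_observation_def\<close>)
  have d_nonneg: "0 \<le> ?d k g h" and y_nonneg: "0 \<le> ?y k g" for k g h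
    by (simp_all add: cond_expectation_def transition_count_nonneg at_risk_count_nonneg)
  have d_sum_le: "(\<Sum>h\<in>S. ?d k g h) \<le> ?y k g" if "k \<in> {1..K}" "finite S" for k g S
  proof -
    have "(\<Sum>h\<in>S. ?d k g h) = (\<integral>\<omega>. (\<Sum>h\<in>S. ?D \<omega> k g h) \<partial>?P)"
      unfolding cond_expectation_def using int_D that
      by (intro Bochner_Integration.integral_sum[symmetric]) auto
    also have "\<dots> \<le> ?y k g"
      unfolding cond_expectation_def using int_D int_R that
      by (intro integral_mono Bochner_Integration.integrable_sum sum_transition_count_le) auto
    finally show ?thesis .
  qed
  have d_le: "?d k g h \<le> ?y k g" if "k \<in> {1..K}" for k g h
    using d_sum_le[OF that, of "{h}" g] by simp
  have update: "alpha_update V ?d ?y k g h = ?d k g h / ?y k g" if "k \<in> {1..K}" for k g h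
  proof -
    \<comment> \<open>The set of successors of \<open>g\<close> is thus finite, and
      \<open>d_sum_le\<close> applied to it forces \<open>mu\<close> to vanish.\<close>
    have "{h'. (g, h') \<in> V} \<subseteq> {1..H}"
      using assms(1) by auto
    then have "finite {h'. (g, h') \<in> V}"
      by (rule finite_subset) simp
    then have "mu V ?d ?y k g = 0"
      using d_sum_le[OF that] by (simp add: mu_def)
    then show ?thesis
      by (simp add: alpha_update_def)
  qed
  have V_bounds: "0 \<le> \<alpha> k g h \<and> \<alpha> k g h \<le> 1"
    if "\<alpha> \<in> alpha_region H K" "k \<in> {1..K}" "(g, h) \<in> V" for \<alpha> k g h
    using alpha_region_bounds[OF that(1,2)] that(3) assms(1) by blast
  have EL: "?EL \<alpha> = complete_loglik K V ?d ?y \<alpha>" if "\<alpha> \<in> alpha_region H K" for \<alpha>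
    by (rule cond_expectation_ereal_complete_loglik)
      (use V_bounds[OF that] int_D int_R transition_count_nonneg at_risk_count_nonneg in auto)
  have in_region: "alpha_update V ?d ?y \<in> alpha_region H K"
    unfolding alpha_region_def
  proof (intro CollectI ballI conjI)
    fix k g assume k: "k \<in> {1..K}"
    show "0 \<le> alpha_update V ?d ?y k g h" for h
      using update[OF k] d_nonneg y_nonneg by simp
    have "(\<Sum>h\<in>{1..H} - {g}. alpha_update V ?d ?y k g h) = (\<Sum>h\<in>{1..H} - {g}. ?d k g h) / ?y k g"
      using update[OF k] by (simp add: sum_divide_distrib)
    \<comment> \<open>If the expected number at risk is 0, the quotient is 0 by the convention for
      division.\<close>
    also have "\<dots> \<le> 1"
      using d_sum_le[OF k, of "{1..H} - {g}" g] y_nonneg[of k g]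
      by (cases "?y k g = 0") (auto simp: divide_le_eq_1)
    finally show "(\<Sum>h\<in>{1..H} - {g}. alpha_update V ?d ?y k g h) \<le> 1" .
  qed
  \<comment> \<open>Since the update itself lies in the region, both sides can be rewritten by the
    closed form \<open>EL\<close> and compared termwise.\<close>
  have "?EL \<alpha> \<le> ?EL (alpha_update V ?d ?y)" if "\<alpha> \<in> alpha_region H K" for \<alpha>
    unfolding EL[OF that] EL[OF in_region]
    using V_bounds[OF that] d_nonneg update d_le
    by (intro complete_loglik_le_ratio) auto
  then have "is_arg_max ?EL (\<lambda>\<alpha>. \<alpha> \<in> alpha_region H K) (alpha_update V ?d ?y)"
    using in_region unfolding is_arg_max_def by (auto simp: not_less)
  with EL show ?thesis
    unfolding Let_def by blast
qed

end
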